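(* Let $(L,\psi,h)$ be a polarised pure integral Hodge structure, and let $L=L_1\perp\cdots\perp L_r$ be an orthogonal decomposition into indecomposable polarised integral Hodge substructures. Then the set of sublattices $\{L_\nu\}$ is uniquely determined by $L$: any other such decomposition has the same set of summands.
   Context: A pure integral Hodge structure of weight $n$ is a finitely generated free $\mathbb{Z}$-module $L$ with a decomposition $L\otimes\mathbb{C}=\bigoplus_{p+q=n}V^{p,q}$ satisfying $\overline{V^{p,q}}=V^{q,p}$ (complex conjugation acting on the factor $\mathbb{C}$); equivalently a real representation $h:\mathbb{C}^\times\to\mathrm{GL}(L_\mathbb{R})$ with $h(z)$ acting on $V^{p,q}$ by $z^{-p}\bar z^{-q}$. A polarisation is a $\mathbb{Z}$-bilinear pairing $\psi:L\times L\to(2\pi i)^{-n}\mathbb{Z}$ such that $\psi_\mathbb{R}(h(z)x,h(z)y)=(z\bar z)^{-n}\psi_\mathbb{R}(x,y)$ for all $x,y\in L_\mathbb{R}$, $z\in\mathbb{C}^\times$, and $\varphi(x,y)=(2\pi i)^n\psi_\mathbb{R}(x,h(i)y)$ is a real symmetric positive-definite form on $L_\mathbb{R}$. An orthogonal decomposition $L=L_1\perp\cdots\perp L_r$ means $L=\bigoplus_\nu L_\nu$ with each $L_\nu$ a $\mathbb{Z}$-submodule such that $L_\nu\otimes\mathbb{R}$ is stable under $h(z)$ for all $z\in\mathbb{C}^\times$, and $\psi(L_\nu,L_\mu)=0$ for $\nu\neq\mu$. A nonzero polarised structure is indecomposable if in every orthogonal decomposition $L=L_1\perp L_2$ one of $L_1,L_2$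 is $0$; substructures carry the restricted $\psi$ and $h$. *)

theory Defs
  imports "HOL-Analysis.Product_Vector"
begin

text \<open>
  A finitely generated free \<open>\<int>\<close>-module \<open>L\<close> is identified with its image in \<open>L \<otimes> \<real>\<close>: it is the set
  of integral combinations of a finite, linearly independent (over \<open>\<real>\<close>) subset of a real
  vector space. Then \<open>L \<otimes> \<real>\<close> is \<open>span L\<close>, also for submodules of \<open>L\<close>. The ambient vector space
  may be larger than \<open>span L\<close>, so that \<open>L\<close> and its substructures are objects of the same kind;
  forms and actions are only ever inspected on \<open>L\<close> or \<open>span L\<close>, and so are restricted implicitly.
\<close>

definition zscale :: "int \<Rightarrow> 'v::real_vector \<Rightarrow> 'v"
  where "zscale k x = of_int k *\<^sub>R x"

global_interpretation zmod: module "zscale :: int \<Rightarrow> 'v::real_vector \<Rightarrow> 'v"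
  by unfold_locales (simp_all add: zscale_def algebra_simps)

definition free_lattice :: "'v::real_vector set \<Rightarrow> bool"
  where "free_lattice L \<longleftrightarrow> (\<exists>B. finite B \<and> independent B \<and> L = zmod.span B)"

definition linear_within :: "'v::real_vector set \<Rightarrow> ('v \<Rightarrow> 'w::real_vector) \<Rightarrow> bool"
  where "linear_within S f \<longleftrightarrow>
    (\<forall>x\<in>S. \<forall>y\<in>S. f (x + y) = f x + f y) \<and> (\<forall>c. \<forall>x\<in>S. f (c *\<^sub>R x) = c *\<^sub>R f x)"

definition bilinear_within :: "'v::real_vector set \<Rightarrow> ('v \<Rightarrow> 'v \<Rightarrow> 'w::real_vector) \<Rightarrow> bool"
  where "bilinear_within S b \<longleftrightarrow>
    (\<forall>x\<in>S. linear_within S (b x) \<and> linear_within S (\<lambda>y. b y x))"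

definition zbilinear_within :: "'v::real_vector set \<Rightarrow> ('v \<Rightarrow> 'v \<Rightarrow> 'w::real_vector) \<Rightarrow> bool"
  where "zbilinear_within L b \<longleftrightarrow>
    (\<forall>x\<in>L. \<forall>y\<in>L. \<forall>z\<in>L. b (x + y) z = b x z + b y z \<and> b z (x + y) = b z x + b z y) \<and>
    (\<forall>k. \<forall>x\<in>L. \<forall>y\<in>L. b (zscale k x) y = zscale k (b x y) \<and> b x (zscale k y) = zscale k (b x y))"

definition internal_direct_sum :: "'i set \<Rightarrow> ('i \<Rightarrow> 'g::ab_group_add set) \<Rightarrow> 'g set \<Rightarrow> bool"
  where "internal_direct_sum I M U \<longleftrightarrow>
    (\<forall>i\<in>I. M i \<subseteq> U) \<and>
    (\<forall>x\<in>U. \<exists>!f. (\<forall>i\<in>I. f i \<in> M i) \<and> (\<forall>i. i \<notin> I \<longrightarrow> f i = 0) \<and>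
                 finite {i. f i \<noteq> 0} \<and> x = (\<Sum>i | f i \<noteq> 0. f i))"

text \<open>
  The complexification of a real vector space \<open>S\<close> is \<open>S \<times> S\<close>, where \<open>(x, y)\<close> stands for
  \<open>x \<otimes> 1 + y \<otimes> \<i>\<close>. The complex conjugation is the one on the second tensor factor.
\<close>

definition cscale :: "complex \<Rightarrow> 'v \<times> 'v \<Rightarrow> 'v::real_vector \<times> 'v"
  where "cscale c v = (Re c *\<^sub>R fst v - Im c *\<^sub>R snd v, Im c *\<^sub>R fst v + Re c *\<^sub>R snd v)"

global_interpretation complexification:
  vector_space "cscale :: complex \<Rightarrow> 'v \<times> 'v \<Rightarrow> 'v::real_vector \<times> 'v"
  by unfold_locales (auto simp: cscale_def prod_eq_iff algebra_simps)

definition conjugation :: "'v \<times> 'v \<Rightarrow> 'v::real_vector \<times> 'v"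
  where "conjugation v = (fst v, - snd v)"

definition hodge_decomposition ::
    "int \<Rightarrow> 'v::real_vector set \<Rightarrow> (int \<times> int \<Rightarrow> ('v \<times> 'v) set) \<Rightarrow> bool"
  where "hodge_decomposition n L V \<longleftrightarrow>
    (\<forall>p q. p + q = n \<longrightarrow>
      complexification.subspace (V (p, q)) \<and> conjugation ` V (p, q) = V (q, p)) \<and>
    internal_direct_sum {(p, q). p + q = n} V (span L \<times> span L)"

definition real_representation ::
    "'v::real_vector set \<Rightarrow> (complex \<Rightarrow> 'v \<Rightarrow> 'v) \<Rightarrow> bool"
  where "real_representation S h \<longleftrightarrow>
    (\<forall>z. z \<noteq> 0 \<longrightarrow> linear_within S (h z) \<and> h z ` S \<subseteq> S) \<and>
    (\<forall>x\<in>S. h 1 x = x) \<and>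
    (\<forall>z w. z \<noteq> 0 \<longrightarrow> w \<noteq> 0 \<longrightarrow> (\<forall>x\<in>S. h (z * w) x = h z (h w x)))"

text \<open>
  On the complexification \<open>h z\<close> acts componentwise. The decomposition and the action
  determine each other on \<open>span L\<close>.
\<close>

definition pure_hodge_structure ::
    "int \<Rightarrow> 'v::real_vector set \<Rightarrow> (complex \<Rightarrow> 'v \<Rightarrow> 'v) \<Rightarrow> bool"
  where "pure_hodge_structure n L h \<longleftrightarrow>
    free_lattice L \<and>
    real_representation (span L) h \<and>
    (\<exists>V. hodge_decomposition n L V \<and>
      (\<forall>p q. p + q = n \<longrightarrow> (\<forall>v\<in>V (p, q). \<forall>z. z \<noteq> 0 \<longrightarrow>
        map_prod (h z) (h z) v = cscale (z powi (- p) * cnj z powi (- q)) v)))"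

text \<open>
  \<open>\<psi>R\<close> below is the \<open>\<real>\<close>-bilinear extension of \<open>\<psi>\<close> to \<open>span L\<close>, which always exists
  and is unique there.
\<close>

definition polarisation ::
    "int \<Rightarrow> 'v::real_vector set \<Rightarrow> (complex \<Rightarrow> 'v \<Rightarrow> 'v) \<Rightarrow> ('v \<Rightarrow> 'v \<Rightarrow> complex) \<Rightarrow> bool"
  where "polarisation n L h \<psi> \<longleftrightarrow>
    zbilinear_within L \<psi> \<and>
    (\<forall>x\<in>L. \<forall>y\<in>L. \<exists>k::int. \<psi> x y = (2 * of_real pi * \<i>) powi (- n) * of_int k) \<and>
    (\<exists>\<psi>R. bilinear_within (span L) \<psi>R \<and> (\<forall>x\<in>L. \<forall>y\<in>L. \<psi>R x y = \<psi> x y) \<and>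
      (\<forall>z. z \<noteq> 0 \<longrightarrow> (\<forall>x\<in>span L. \<forall>y\<in>span L.
        \<psi>R (h z x) (h z y) = (z * cnj z) powi (- n) * \<psi>R x y)) \<and>
      (let \<phi> = (\<lambda>x y. (2 * of_real pi * \<i>) powi n * \<psi>R x (h \<i> y)) in
        (\<forall>x\<in>span L. \<forall>y\<in>span L. \<phi> x y \<in> \<real> \<and> \<phi> x y = \<phi> y x) \<and>
        (\<forall>x\<in>span L. x \<noteq> 0 \<longrightarrow> Re (\<phi> x x) > 0)))"

definition polarised_hodge_structure ::
    "int \<Rightarrow> 'v::real_vector set \<Rightarrow> ('v \<Rightarrow> 'v \<Rightarrow> complex) \<Rightarrow> (complex \<Rightarrow> 'v \<Rightarrow> 'v) \<Rightarrow> bool"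
  where "polarised_hodge_structure n L \<psi> h \<longleftrightarrow>
    pure_hodge_structure n L h \<and> polarisation n L h \<psi>"

definition orthogonal_decomposition ::
    "'v::real_vector set \<Rightarrow> ('v \<Rightarrow> 'v \<Rightarrow> complex) \<Rightarrow> (complex \<Rightarrow> 'v \<Rightarrow> 'v) \<Rightarrow>
      'i set \<Rightarrow> ('i \<Rightarrow> 'v set) \<Rightarrow> bool"
  where "orthogonal_decomposition L \<psi> h I M \<longleftrightarrow>
    (\<forall>\<nu>\<in>I. zmod.subspace (M \<nu>) \<and> (\<forall>z. z \<noteq> 0 \<longrightarrow> h z ` span (M \<nu>) \<subseteq> span (M \<nu>))) \<and>
    internal_direct_sum I M L \<and>
    (\<forall>\<nu>\<in>I. \<forall>\<mu>\<in>I. \<nu> \<noteq> \<mu> \<longrightarrow> (\<forall>x\<in>M \<nu>. \<forall>y\<in>M \<mu>. \<psi> x y = 0))"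

definition indecomposable ::
    "int \<Rightarrow> 'v::real_vector set \<Rightarrow> ('v \<Rightarrow> 'v \<Rightarrow> complex) \<Rightarrow> (complex \<Rightarrow> 'v \<Rightarrow> 'v) \<Rightarrow> bool"
  where "indecomposable n L \<psi> h \<longleftrightarrow>
    polarised_hodge_structure n L \<psi> h \<and> L \<noteq> {0} \<and>
    (\<forall>M. orthogonal_decomposition L \<psi> h {1, 2::nat} M \<longrightarrow> M 1 = {0} \<or> M 2 = {0})"

end

theory Submission
  imports Defs "HOL-Library.FuncSet"
begin

text \<open>
  The real form \<open>\<phi>(x, y) = (2\<pi>\<i>)\<^sup>n \<psi>(x, h(\<i>)y)\<close> is positive definite on \<open>L \<otimes> \<real>\<close>, and for substructures orthogonality under \<open>\<psi>\<close>
  becomes orthogonality under \<open>\<phi>\<close>. Although \<open>\<phi>\<close> need not be rational on \<open>L\<close>, only finitely many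
  elements of \<open>L\<close> have bounded norm. Let \<open>A\<close> and \<open>C\<close> be summands of two orthogonal decompositions.
  Following Kneser, split an element of \<open>L\<close> alternately along \<open>L = A \<perp> A\<^sup>\<perp>\<close> and \<open>L = C \<perp> C\<^sup>\<perp>\<close>; each
  proper split lowers the norm, so the process ends, with parts that are homogeneous for both
  decompositions. Hence \<open>A = (A \<inter> C) \<perp> (A \<inter> C\<^sup>\<perp>)\<close>, and if \<open>A\<close> is indecomposable then
  \<open>A \<inter> C = 0\<close> or \<open>A \<subseteq> C\<close>.
\<close>

section \<open>Positive definite forms on a real subspace\<close>

text \<open>The form is constrained only on the carrier \<open>S\<close>: the ambient space may be
  larger than the real span of the lattice, and nothing is known about the form outside that
  span.\<close>

locale positive_definite_form =
  fixes S :: "'v::real_vector set" and f :: "'v \<Rightarrow> 'v \<Rightarrow> real"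
  assumes subspace_S: "subspace S"
    and add_left: "\<lbrakk>x \<in> S; y \<in> S; z \<in> S\<rbrakk> \<Longrightarrow> f (x + y) z = f x z + f y z"
    and scale_left: "\<lbrakk>x \<in> S; z \<in> S\<rbrakk> \<Longrightarrow> f (c *\<^sub>R x) z = c * f x z"
    and commute: "\<lbrakk>x \<in> S; y \<in> S\<rbrakk> \<Longrightarrow> f x y = f y x"
    and pos: "\<lbrakk>x \<in> S; x \<noteq> 0\<rbrakk> \<Longrightarrow> f x x > 0"
begin

lemmas S_closed = subspace_0[OF subspace_S] subspace_add[OF subspace_S]
  subspace_scale[OF subspace_S] subspace_diff[OF subspace_S] subspace_sum[OF subspace_S]

lemma add_right: "\<lbrakk>x \<in> S; y \<in> S; z \<in> S\<rbrakk> \<Longrightarrow> f z (x + y) = f z x + f z y"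
  using add_left[of x y z] commute by (simp add: S_closed)

lemma scale_right: "\<lbrakk>x \<in> S; z \<in> S\<rbrakk> \<Longrightarrow> f z (c *\<^sub>R x) = c * f z x"
  using scale_left[of x z c] commute by (simp add: S_closed)

lemma zero_left: "z \<in> S \<Longrightarrow> f 0 z = 0"
  using scale_left[of 0 z 0] by (simp add: S_closed)

lemma zero_right: "z \<in> S \<Longrightarrow> f z 0 = 0"
  using scale_right[of 0 z 0] by (simp add: S_closed)

lemma diff_left: "\<lbrakk>x \<in> S; y \<in> S; z \<in> S\<rbrakk> \<Longrightarrow> f (x - y) z = f x z - f y z"
  using add_left[of "x - y" y z] by (simp add: S_closed)

lemma diff_right: "\<lbrakk>x \<in> S; y \<in> S; z \<in> S\<rbrakk> \<Longrightarrow> f z (x - y) = f z x - f z y"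
  using add_right[of "x - y" y z] by (simp add: S_closed)

lemma sum_left:
  assumes "\<And>i. i \<in> I \<Longrightarrow> g i \<in> S" "z \<in> S"
  shows "f (sum g I) z = (\<Sum>i\<in>I. f (g i) z)"
  using assms
  by (induction I rule: infinite_finite_induct) (auto simp: zero_left add_left S_closed)

lemma nonneg: "x \<in> S \<Longrightarrow> f x x \<ge> 0"
  using pos[of x] zero_left[of 0] by (cases "x = 0") (auto simp: S_closed)

lemma self_eq_0: "\<lbrakk>x \<in> S; f x x = 0\<rbrakk> \<Longrightarrow> x = 0"
  using pos[of x] by force

lemma orthogonal_span:
  assumes "T \<subseteq> S" "x \<in> S" "\<And>y. y \<in> T \<Longrightarrow> f y x = 0" "y \<in> span T"
  shows "f y x = 0"
proof -
  have "y \<in> S \<and> f y x = 0"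
    using assms(4)
  proof (induction rule: span_induct_alt)
    case base
    then show ?case using assms by (simp add: S_closed zero_left)
  next
    case (step c a b)
    then have "a \<in> S" using assms by blast
    with step assms show ?case by (simp add: S_closed add_left scale_left)
  qed
  then show ?thesis ..
qed

lemma Cauchy_Schwarz:
  assumes "x \<in> S" "w \<in> S"
  shows "(f x w)\<^sup>2 \<le> f x x * f w w"
proof (cases "w = 0")
  case True
  then show ?thesis using assms by (simp add: zero_right)
next
  case False
  with assms have w: "f w w > 0" by (simp add: pos)
  \<comment> \<open>The coefficient of the projection of \<open>x\<close> to the line through
    \<open>w\<close>; it minimises the norm of \<open>x - t *\<^sub>R w\<close>.\<close>
  define t where "t = f x w / f w w"
  have "0 \<le> f (x - t *\<^sub>R w) (x - t *\<^sub>R w)"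
    using assms by (intro nonneg) (simp add: S_closed)
  also have "\<dots> = f x x - 2 * t * f x w + t\<^sup>2 * f w w"
    using assms commute[of w x]
    by (simp add: S_closed diff_left diff_right scale_left scale_right power2_eq_square
        algebra_simps)
  also have "\<dots> = f x x - (f x w)\<^sup>2 / f w w"
    using w by (simp add: t_def field_simps power2_eq_square)
  finally show ?thesis using w by (simp add: field_simps)
qed

text \<open>Gram-Schmidt, one generator at a time: \<open>b\<close> is first made orthogonal to the
  span already treated, and \<open>v\<close> is then corrected along the resulting
  direction.\<close>

lemma orthogonal_projection:
  assumes "finite B" "B \<subseteq> S" "v \<in> S"
  shows "\<exists>u\<in>span B. \<forall>y\<in>span B. f y (v - u) = 0"
  using assms
proof (induction B arbitrary: v rule: finite_induct)
  case empty
  then show ?case by (simp add: zero_left)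
next
  case (insert b B)
  have BS: "span B \<subseteq> S" using insert.prems subspace_S by (simp add: span_minimal)
  have bS: "b \<in> S" using insert.prems by simp
  obtain p where p: "p \<in> span B" "\<forall>y\<in>span B. f y (b - p) = 0"
    using insert.IH[of b] insert.prems by auto
  obtain u where u: "u \<in> span B" "\<forall>y\<in>span B. f y (v - u) = 0"
    using insert.IH[of v] insert.prems by auto
  define w where "w = b - p"
  \<comment> \<open>If \<open>b\<close> already lies in \<open>span B\<close>, then
    \<open>w = 0\<close>, division by zero gives \<open>t = 0\<close>, and the old projection
    \<open>u\<close> is kept.\<close>
  define t where "t = f w (v - u) / f w w"
  have wS: "w \<in> S" using bS p(1) BS by (auto simp: w_def S_closed)
  have uS: "u \<in> S" using u(1) BS by auto
  have sub: "span B \<subseteq> span (insert b B)" by (intro span_mono) auto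
  have w_span: "w \<in> span (insert b B)"
    unfolding w_def using p(1) sub by (intro span_diff) (auto intro: span_base)
  have B0: "f y (v - (u + t *\<^sub>R w)) = 0" if "y \<in> span B" for y
  proof -
    have "f y (v - u - t *\<^sub>R w) = f y (v - u) - t * f y w"
      using that BS wS uS insert.prems by (subst diff_right) (auto simp: scale_right S_closed)
    then show ?thesis using that p u by (simp add: w_def diff_diff_add)
  qed
  have w0: "f w (v - (u + t *\<^sub>R w)) = 0"
  proof -
    have "f w (v - u - t *\<^sub>R w) = f w (v - u) - t * f w w"
      using wS uS insert.prems by (subst diff_right) (auto simp: scale_right S_closed)
    also have "\<dots> = 0"
    proof (cases "w = 0")
      case True
      then show ?thesis using uS insert.prems by (simp add: zero_left S_closed)
    next
      case False
      then show ?thesis using pos[OF wS] by (simp add: t_def)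
    qed
    finally show ?thesis by (simp add: diff_diff_add)
  qed
  have b0: "f b (v - (u + t *\<^sub>R w)) = 0"
  proof -
    have "f (w + p) (v - (u + t *\<^sub>R w)) = 0"
      using w0 B0[OF p(1)] p(1) BS wS uS insert.prems
      by (subst add_left) (auto simp: S_closed)
    then show ?thesis by (simp add: w_def)
  qed
  have "v - (u + t *\<^sub>R w) \<in> S"
    using insert.prems uS wS by (simp add: S_closed)
  moreover have "f y (v - (u + t *\<^sub>R w)) = 0" if "y \<in> insert b B" for y
    using that b0 B0 span_base by blast
  ultimately have "\<forall>y\<in>span (insert b B). f y (v - (u + t *\<^sub>R w)) = 0"
    using insert.prems(1) orthogonal_span by blast
  moreover have "u + t *\<^sub>R w \<in> span (insert b B)"
    using u(1) sub w_span by (auto intro!: span_add span_scale)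
  ultimately show ?case by blast
qed

section \<open>Finiteness of the set of lattice points of bounded norm\<close>

text \<open>Each coordinate is bounded by itself: pairing with a multiple of the dual basis vector
  isolates the coefficient of \<open>b\<close>, and Cauchy-Schwarz bounds the pairing. Integrality
  leaves finitely many coefficient vectors.\<close>

lemma finite_bounded_lattice_points:
  assumes "finite B" "independent B" "B \<subseteq> S"
  shows "finite {x \<in> zmod.span B. f x x \<le> C}"
proof -
  have "\<exists>K. \<forall>k. f (\<Sum>a\<in>B. zscale (k a) a) (\<Sum>a\<in>B. zscale (k a) a) \<le> C \<longrightarrow> k b \<in> {-K..K::int}"
    if b: "b \<in> B" for b
  proof -
    obtain p where p: "p \<in> span (B - {b})" "\<forall>y\<in>span (B - {b}). f y (b - p) = 0"
      using orthogonal_projection[of "B - {b}" b] assms b by auto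
    define w where "w = b - p"
    have bS: "b \<in> S" using b assms by blast
    have "span (B - {b}) \<subseteq> S" using assms subspace_S by (intro span_minimal) auto
    with p have pS: "p \<in> S" by blast
    have wS: "w \<in> S" using bS pS by (simp add: w_def S_closed)
    have "w \<noteq> 0"
      using p(1) b assms(2) by (auto simp: w_def dependent_def)
    with wS have w: "f w w > 0" by (simp add: pos)
    have "f (w + p) w = f w w"
      using p wS pS by (subst add_left) (auto simp: w_def)
    then have bw: "f b w = f w w" by (simp add: w_def)
    define K where "K = \<lceil>sqrt (C * f w w) / f w w\<rceil>"
    have "k b \<in> {-K..K}"
      if k: "f (\<Sum>a\<in>B. zscale (k a) a) (\<Sum>a\<in>B. zscale (k a) a) \<le> C" for k :: "'v \<Rightarrow> int"
    proof -
      define x where "x = (\<Sum>a\<in>B. zscale (k a) a)"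
      have xS: "x \<in> S" using assms by (auto simp: x_def zscale_def intro!: S_closed)
      have "f x w = (\<Sum>a\<in>B. of_int (k a) * f a w)"
        using assms wS unfolding x_def zscale_def
        by (subst sum_left) (auto simp: S_closed scale_left subset_iff)
      also have "\<dots> = of_int (k b) * f b w + (\<Sum>a\<in>B - {b}. of_int (k a) * f a w)"
        using assms b by (simp add: sum.remove)
      also have "(\<Sum>a\<in>B - {b}. of_int (k a) * f a w) = 0"
        using p(2) by (intro sum.neutral) (auto simp: w_def span_base)
      finally have fx: "f x w = of_int (k b) * f w w" using bw by simp
      have "(of_int (k b) * f w w)\<^sup>2 \<le> C * f w w"
        using Cauchy_Schwarz[OF xS wS] k w unfolding fx x_def[symmetric]
        by (meson mult_right_mono less_imp_le order_trans)
      then have "\<bar>of_int (k b) * f w w\<bar> \<le> sqrt (C * f w w)"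
        by (metis real_sqrt_abs real_sqrt_le_mono)
      then have "\<bar>real_of_int (k b)\<bar> \<le> sqrt (C * f w w) / f w w"
        using w by (simp add: abs_mult field_simps)
      also have "\<dots> \<le> of_int K" by (simp add: K_def)
      finally show ?thesis by auto
    qed
    then show ?thesis by blast
  qed
  then obtain K where K: "\<And>b k. \<lbrakk>b \<in> B;
      f (\<Sum>a\<in>B. zscale (k a) a) (\<Sum>a\<in>B. zscale (k a) a) \<le> C\<rbrakk> \<Longrightarrow> k b \<in> {-K b..K b::int}"
    by metis
  have "{x \<in> zmod.span B. f x x \<le> C} \<subseteq>
    (\<lambda>k. \<Sum>a\<in>B. zscale (k a) a) ` (\<Pi>\<^sub>E b\<in>B. {-K b..K b})"
  proof clarify
    fix x assume x: "x \<in> zmod.span B" "f x x \<le> C"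
    then obtain k where k: "x = (\<Sum>a\<in>B. zscale (k a) a)"
      using zmod.span_finite[OF assms(1)] by auto
    \<comment> \<open>Values of \<open>k\<close> off \<open>B\<close> do not affect the sum;
      restricting puts the coefficients into the extensional product, which is finite.\<close>
    then have "x = (\<Sum>a\<in>B. zscale (restrict k B a) a)" by simp
    moreover have "restrict k B \<in> (\<Pi>\<^sub>E b\<in>B. {-K b..K b})"
      using K[of _ k] x(2) k by auto
    ultimately show "x \<in> (\<lambda>k. \<Sum>a\<in>B. zscale (k a) a) ` (\<Pi>\<^sub>E b\<in>B. {-K b..K b})"
      by blast
  qed
  then show ?thesis
    by (rule finite_subset) (intro finite_imageI finite_PiE assms(1) finite_atLeastAtMost_int)
qed

section \<open>Orthogonal summands of a lattice and their common refinement\<close>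

definition orthogonal_complement :: "'v set \<Rightarrow> 'v set \<Rightarrow> 'v set"
  where "orthogonal_complement L A = {x \<in> L. \<forall>y\<in>A. f y x = 0}"

text \<open>Only existence of the splitting is demanded; by positivity a summand inside
  \<open>S\<close> meets its complement in 0 alone, so the splitting is unique. The notion involves
  lattice and norm only, not the Hodge action.\<close>

definition orthogonal_summand :: "'v set \<Rightarrow> 'v set \<Rightarrow> bool"
  where "orthogonal_summand L A \<longleftrightarrow> zmod.subspace A \<and> A \<subseteq> L \<and>
    (\<forall>x\<in>L. \<exists>a\<in>A. \<exists>b\<in>orthogonal_complement L A. x = a + b)"

lemma subspace_orthogonal_complement:
  assumes "zmod.subspace L" "L \<subseteq> S" "A \<subseteq> S"
  shows "zmod.subspace (orthogonal_complement L A)"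
proof (rule zmod.subspaceI)
  show "0 \<in> orthogonal_complement L A"
    using assms zmod.subspace_0 by (auto simp: orthogonal_complement_def zero_right)
next
  fix x y assume "x \<in> orthogonal_complement L A" "y \<in> orthogonal_complement L A"
  then show "x + y \<in> orthogonal_complement L A"
    using assms zmod.subspace_add[of L x y]
    by (auto simp: orthogonal_complement_def add_right subset_iff)
next
  fix k x assume "x \<in> orthogonal_complement L A"
  then show "zscale k x \<in> orthogonal_complement L A"
    using assms zmod.subspace_scale[of L x k]
    by (auto simp: orthogonal_complement_def scale_right subset_iff zscale_def)
qed

lemma summand_inter_complement:
  assumes "A \<subseteq> S" "x \<in> A" "x \<in> orthogonal_complement L A"
  shows "x = 0"
  using assms self_eq_0 by (auto simp: orthogonal_complement_def)

lemma common_refinement: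
  assumes L: "zmod.subspace L" "L \<subseteq> S" "\<And>C. finite {x \<in> L. f x x \<le> C}"
    and A: "orthogonal_summand L A" and N: "orthogonal_summand L N"
    and x: "x \<in> L"
  defines "A' \<equiv> orthogonal_complement L A" and "N' \<equiv> orthogonal_complement L N"
  shows "\<exists>a\<in>A \<inter> N. \<exists>b\<in>A \<inter> N'. \<exists>c\<in>A' \<inter> N. \<exists>d\<in>A' \<inter> N'. x = a + b + c + d"
    (is "?P x")
  using x
\<comment> \<open>Norms are real, so the induction runs over the number of lattice elements of
  smaller norm, which is finite by hypothesis.\<close>
proof (induction "card {y \<in> L. f y y < f x x}" arbitrary: x rule: less_induct)
  case less
  have sub: "zmod.subspace A" "zmod.subspace A'" "zmod.subspace N" "zmod.subspace N'"
    using A N L unfolding orthogonal_summand_def A'_def N'_def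
    by (auto intro!: subspace_orthogonal_complement)
  note zero = sub[THEN zmod.subspace_0]
  have P_add: "?P (y + z)" if y: "?P y" and z: "?P z" for y z
  proof -
    obtain a b c d where 1: "a \<in> A \<inter> N" "b \<in> A \<inter> N'" "c \<in> A' \<inter> N" "d \<in> A' \<inter> N'"
      "y = a + b + c + d" using y by blast
    obtain a' b' c' d' where 2: "a' \<in> A \<inter> N" "b' \<in> A \<inter> N'" "c' \<in> A' \<inter> N" "d' \<in> A' \<inter> N'"
      "z = a' + b' + c' + d'" using z by blast
    have "a + a' \<in> A \<inter> N" "b + b' \<in> A \<inter> N'" "c + c' \<in> A' \<inter> N" "d + d' \<in> A' \<inter> N'"
      using 1(1-4) 2(1-4) sub by (auto intro: zmod.subspace_add)
    moreover have "y + z = (a + a') + (b + b') + (c + c') + (d + d')"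
      using 1(5) 2(5) by simp
    ultimately show ?thesis by blast
  qed
  have smaller: "?P y" if "y \<in> L" "f y y < f x x" for y
  proof (rule less.hyps)
    have "finite {y \<in> L. f y y < f x x}"
      by (rule finite_subset[OF _ L(3)[of "f x x"]]) auto
    \<comment> \<open>The inclusion is strict because \<open>y\<close> lies in the larger set
      only.\<close>
    moreover have "{z \<in> L. f z z < f y y} \<subset> {y \<in> L. f y y < f x x}"
      using that by auto
    ultimately show "card {z \<in> L. f z z < f y y} < card {y \<in> L. f y y < f x x}"
      by (rule psubset_card_mono)
  qed (use that in auto)
  \<comment> \<open>By Pythagoras, when both parts of \<open>x\<close> are nonzero each has smaller
    norm, so both can be refined and the refinements added.\<close>
  have split: "x \<in> D \<or> x \<in> orthogonal_complement L D \<or> ?P x" if D: "orthogonal_summand L D" for D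
  proof -
    obtain a b where ab: "a \<in> D" "b \<in> orthogonal_complement L D" "x = a + b"
      using D less.prems unfolding orthogonal_summand_def by blast
    have L': "a \<in> L" "b \<in> L" and ortho: "f a b = 0"
      using ab D by (auto simp: orthogonal_summand_def orthogonal_complement_def)
    then have S: "a \<in> S" "b \<in> S" using L(2) by auto
    have "f b a = 0" using ortho S commute by simp
    then have norm: "f x x = f a a + f b b"
      using S ortho by (simp add: ab(3) add_left add_right S_closed)
    show ?thesis
    proof (cases "a = 0 \<or> b = 0")
      case True
      then show ?thesis using ab by auto
    next
      case False
      then have "f a a > 0" "f b b > 0" using S pos by auto
      then have "?P a" "?P b" using L' norm by (auto intro!: smaller)
      then show ?thesis using ab(3) P_add by blast
    qed
  qed
  \<comment> \<open>If neither splitting is proper, \<open>x\<close> is homogeneous for both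
    summands and is its own refinement.\<close>
  consider "x \<in> A \<inter> N" | "x \<in> A \<inter> N'" | "x \<in> A' \<inter> N" | "x \<in> A' \<inter> N'" | "?P x"
    using split[OF A] split[OF N] unfolding A'_def N'_def by blast
  then show ?case
  proof cases
    case 1
    show ?thesis
      by (rule bexI[of _ x], rule bexI[of _ 0], rule bexI[of _ 0], rule bexI[of _ 0])
        (use 1 zero in auto)
  next
    case 2
    show ?thesis
      by (rule bexI[of _ 0], rule bexI[of _ x], rule bexI[of _ 0], rule bexI[of _ 0])
        (use 2 zero in auto)
  next
    case 3
    show ?thesis
      by (rule bexI[of _ 0], rule bexI[of _ 0], rule bexI[of _ x], rule bexI[of _ 0])
        (use 3 zero in auto)
  next
    case 4
    show ?thesis
      by (rule bexI[of _ 0], rule bexI[of _ 0], rule bexI[of _ 0], rule bexI[of _ x])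
        (use 4 zero in auto)
  qed
qed

text \<open>In the four-part refinement of an element of \<open>A\<close>, the two parts in the
  complement of \<open>A\<close> have a sum lying also in \<open>A\<close>, and positivity kills
  it.\<close>

lemma summand_split:
  assumes L: "zmod.subspace L" "L \<subseteq> S" "\<And>C. finite {x \<in> L. f x x \<le> C}"
    and A: "orthogonal_summand L A" and N: "orthogonal_summand L N"
    and x: "x \<in> A"
  shows "\<exists>a\<in>A \<inter> N. \<exists>b\<in>A \<inter> orthogonal_complement L N. x = a + b"
proof -
  have AL: "A \<subseteq> L" "zmod.subspace A" using A by (auto simp: orthogonal_summand_def)
  let ?A' = "orthogonal_complement L A" and ?N' = "orthogonal_complement L N"
  have A': "zmod.subspace ?A'" using L AL by (intro subspace_orthogonal_complement) auto
  have "x \<in> L" using x AL by auto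
  from common_refinement[OF L A N this]
  obtain a b c d where *: "a \<in> A \<inter> N" "b \<in> A \<inter> ?N'" "c \<in> ?A' \<inter> N" "d \<in> ?A' \<inter> ?N'"
    "x = a + b + c + d" by blast
  have "x - (a + b) \<in> A" using x *(1,2) AL(2)
    by (intro zmod.subspace_diff zmod.subspace_add) auto
  moreover have "x - (a + b) = c + d" using *(5) by simp
  moreover have "c + d \<in> ?A'" using *(3,4) A' by (intro zmod.subspace_add) auto
  ultimately have "x - (a + b) = 0"
    using AL(1) L(2) by (intro summand_inter_complement[of A]) auto
  then have "x = a + b" by simp
  then show ?thesis using *(1,2) by blast
qed

end

section \<open>Direct sums over finite index sets\<close>

lemma internal_direct_sum_finite:
  assumes "internal_direct_sum I M U" "finite I" "x \<in> U"
  shows "\<exists>g. (\<forall>i\<in>I. g i \<in> M i) \<and> x = sum g I"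
proof -
  obtain g where g: "\<forall>i\<in>I. g i \<in> M i" "\<forall>i. i \<notin> I \<longrightarrow> g i = 0" "x = (\<Sum>i | g i \<noteq> 0. g i)"
    using assms unfolding internal_direct_sum_def by blast
  have "(\<Sum>i | g i \<noteq> 0. g i) = sum g I"
    using g(2) assms(2) by (intro sum.mono_neutral_left) auto
  with g show ?thesis by auto
qed

text \<open>Translates a splitting into two subgroups to the indexed form over \<open>{1, 2}\<close>
  in which \<open>indecomposable\<close> is phrased.\<close>

lemma internal_direct_sum_two:
  fixes A :: "'g::ab_group_add set"
  assumes "A \<subseteq> U" "B \<subseteq> U"
    and ex: "\<And>x. x \<in> U \<Longrightarrow> \<exists>a\<in>A. \<exists>b\<in>B. x = a + b"
    and uniq: "\<And>a b a' b'. \<lbrakk>a \<in> A; b \<in> B; a' \<in> A; b' \<in> B; a + b = a' + b'\<rbrakk> \<Longrightarrow> a = a' \<and> b = b'"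
  shows "internal_direct_sum {1, 2::nat} (\<lambda>i. if i = 1 then A else B) U"
proof -
  have sum2: "finite {i. g i \<noteq> 0}" "(\<Sum>i | g i \<noteq> 0. g i) = g 1 + g 2"
    if "\<forall>i. i \<notin> {1, 2::nat} \<longrightarrow> g i = 0" for g :: "nat \<Rightarrow> 'g"
  proof -
    have sub: "{i. g i \<noteq> 0} \<subseteq> {1, 2}" using that by auto
    then show "finite {i. g i \<noteq> 0}" by (rule finite_subset) simp
    have "(\<Sum>i | g i \<noteq> 0. g i) = sum g {1, 2}"
      using sub by (intro sum.mono_neutral_left) auto
    then show "(\<Sum>i | g i \<noteq> 0. g i) = g 1 + g 2" by simp
  qed
  show ?thesis
    unfolding internal_direct_sum_def
  proof (intro conjI ballI)
    fix x assume "x \<in> U"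
    then obtain a b where ab: "a \<in> A" "b \<in> B" "x = a + b" using ex by blast
    define g where "g i = (if i = (1::nat) then a else if i = 2 then b else 0)" for i
    have g0: "\<forall>i. i \<notin> {1, 2} \<longrightarrow> g i = 0" by (simp add: g_def)
    show "\<exists>!f. (\<forall>i\<in>{1, 2}. f i \<in> (if i = 1 then A else B)) \<and>
      (\<forall>i. i \<notin> {1, 2::nat} \<longrightarrow> f i = 0) \<and> finite {i. f i \<noteq> 0} \<and> x = (\<Sum>i | f i \<noteq> 0. f i)"
    proof (rule ex1I[of _ g])
      show "(\<forall>i\<in>{1, 2}. g i \<in> (if i = 1 then A else B)) \<and>
        (\<forall>i. i \<notin> {1, 2::nat} \<longrightarrow> g i = 0) \<and> finite {i. g i \<noteq> 0} \<and> x = (\<Sum>i | g i \<noteq> 0. g i)"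
        using sum2[OF g0] ab g0 by (simp add: g_def)
    next
      fix k assume k: "(\<forall>i\<in>{1, 2}. k i \<in> (if i = 1 then A else B)) \<and>
        (\<forall>i. i \<notin> {1, 2::nat} \<longrightarrow> k i = 0) \<and> finite {i. k i \<noteq> 0} \<and> x = (\<Sum>i | k i \<noteq> 0. k i)"
      then have "x = k 1 + k 2" using sum2[of k] by auto
      with k ab uniq[of "k 1" "k 2" a b] have "k 1 = a" "k 2 = b" by auto
      with k show "k = g" by (auto simp: g_def fun_eq_iff)
    qed
  qed (use assms(1,2) in \<open>auto split: if_splits\<close>)
qed

section \<open>Orthogonality for the pairing, the real form and the Hodge action\<close>

text \<open>Here \<open>f\<close> stands for the form \<phi>. Its link to \<open>\<psi>R\<close> and
  to \<open>h\<close> is recorded only through vanishing, since beyond positivity just orthogonality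
  has to be transferred; the nonzero factors \<open>(2 * of_real pi * \<i>) powi n\<close> and
  \<open>(z * cnj z) powi (- n)\<close> thus drop out.\<close>

locale hodge_form = positive_definite_form "span L" f
  for L :: "'v::real_vector set" and f +
  fixes \<psi> \<psi>R :: "'v \<Rightarrow> 'v \<Rightarrow> complex" and h :: "complex \<Rightarrow> 'v \<Rightarrow> 'v"
  assumes lattice: "free_lattice L"
    and representation: "real_representation (span L) h"
    and bilinear: "bilinear_within (span L) \<psi>R"
    and extension: "\<lbrakk>x \<in> L; y \<in> L\<rbrakk> \<Longrightarrow> \<psi>R x y = \<psi> x y"
    and form_eq_0: "\<lbrakk>x \<in> span L; y \<in> span L\<rbrakk> \<Longrightarrow> f x y = 0 \<longleftrightarrow> \<psi>R x (h \<i> y) = 0"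
    and form_invariant: "\<lbrakk>z \<noteq> 0; x \<in> span L; y \<in> span L\<rbrakk> \<Longrightarrow> f (h z x) (h z y) = 0 \<longleftrightarrow> f x y = 0"
begin

definition stable :: "'v set \<Rightarrow> bool"
  where "stable A \<longleftrightarrow> (\<forall>z. z \<noteq> 0 \<longrightarrow> h z ` span A \<subseteq> span A)"

lemma subspace_lattice: "zmod.subspace L"
  using lattice by (auto simp: free_lattice_def)

lemma lattice_subset_span: "L \<subseteq> span L"
  by (rule span_superset)

lemma span_subset: "A \<subseteq> L \<Longrightarrow> span A \<subseteq> span L"
  by (rule span_mono)

lemma finite_bounded: "finite {x \<in> L. f x x \<le> C}"
proof -
  obtain B where B: "finite B" "independent B" "L = zmod.span B"
    using lattice by (auto simp: free_lattice_def)
  then have "B \<subseteq> span L" using zmod.span_superset[of B] lattice_subset_span by blast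
  with B show ?thesis using finite_bounded_lattice_points[of B] by simp
qed

lemma h_inverse: "\<lbrakk>z \<noteq> 0; x \<in> span L\<rbrakk> \<Longrightarrow> h z (h (inverse z) x) = x"
  using representation unfolding real_representation_def
  by (metis nonzero_imp_inverse_nonzero right_inverse)

text \<open>By linearity \<open>\<psi>R x\<close> vanishes on \<open>span C\<close>, and stability
  keeps \<open>h \<i> y\<close> in that span.\<close>

lemma form_eq_0_if_orthogonal:
  assumes "A \<subseteq> L" "C \<subseteq> L" "stable C" "\<And>x y. \<lbrakk>x \<in> A; y \<in> C\<rbrakk> \<Longrightarrow> \<psi> x y = 0" "x \<in> A" "y \<in> C"
  shows "f x y = 0"
proof -
  have x: "x \<in> L" "x \<in> span L" using assms lattice_subset_span by blast+
  have y: "y \<in> span L" using assms lattice_subset_span by blast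
  have lin: "linear_within (span L) (\<psi>R x)"
    using bilinear x by (auto simp: bilinear_within_def)
  have "w \<in> span L \<and> \<psi>R x w = 0" if "w \<in> span C" for w
    using that
  proof (induction rule: span_induct_alt)
    case base
    have "\<psi>R x (0 *\<^sub>R 0) = 0 *\<^sub>R \<psi>R x 0"
      using lin span_zero unfolding linear_within_def by blast
    then show ?case by (simp add: span_zero)
  next
    case (step c a b)
    then have a: "a \<in> L" "a \<in> span L" using assms(2) lattice_subset_span by auto
    then have "\<psi>R x a = 0" using step(1) assms(4,5) x extension by simp
    moreover have "\<psi>R x (c *\<^sub>R a + b) = c *\<^sub>R \<psi>R x a + \<psi>R x b"
      using a step lin unfolding linear_within_def by (simp add: span_scale)
    ultimately show ?case using step a by (simp add: span_add span_scale)
  qed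
  moreover have "h \<i> y \<in> span C"
    using assms span_base[of y C] unfolding stable_def by (auto simp: image_subset_iff)
  ultimately show ?thesis using form_eq_0 x y by blast
qed

text \<open>The converse transfer: write \<open>y\<close> as \<open>h \<i>\<close> applied to
  \<open>h (inverse \<i>) y\<close>, which stability keeps in \<open>span C\<close>.\<close>

lemma pairing_eq_0_if_orthogonal:
  assumes "A \<subseteq> L" "C \<subseteq> L" "stable C" "\<And>x y. \<lbrakk>x \<in> A; y \<in> C\<rbrakk> \<Longrightarrow> f y x = 0" "x \<in> A" "y \<in> C"
  shows "\<psi> x y = 0"
proof -
  have x: "x \<in> span L" and y: "y \<in> span L"
    using assms lattice_subset_span by blast+
  have w: "h (inverse \<i>) y \<in> span C"
    using assms span_base[of y C] unfolding stable_def by (auto simp: image_subset_iff)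
  then have wL: "h (inverse \<i>) y \<in> span L" using span_subset[OF assms(2)] by auto
  have "f (h (inverse \<i>) y) x = 0"
    using orthogonal_span[OF _ x _ w] assms(2,4,5) lattice_subset_span by blast
  then have "f x (h (inverse \<i>) y) = 0" using commute x wL by simp
  then have "\<psi>R x (h \<i> (h (inverse \<i>) y)) = 0" using form_eq_0 x wL by blast
  then have "\<psi>R x y = 0" using h_inverse[OF _ y, of \<i>] by simp
  moreover have "x \<in> L" "y \<in> L" using assms(1,2,5,6) by auto
  ultimately show ?thesis using extension by simp
qed

text \<open>The orthogonal complement of a stable module is stable: by invariance \<open>z\<close>
  moves to the other argument as its inverse, and \<open>h (inverse z) y\<close> stays in
  \<open>span C\<close>.\<close>

lemma h_orthogonal:
  assumes "C \<subseteq> L" "stable C" "z \<noteq> 0" "x \<in> span L" "\<And>y. y \<in> C \<Longrightarrow> f y x = 0" "y \<in> C"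
  shows "f y (h z x) = 0"
proof -
  have y: "y \<in> span L" using assms lattice_subset_span by blast
  have w: "h (inverse z) y \<in> span C"
    using assms span_base[of y C] unfolding stable_def by (auto simp: image_subset_iff)
  then have wL: "h (inverse z) y \<in> span L" using span_subset[OF assms(1)] by auto
  have "f (h (inverse z) y) x = 0"
    using orthogonal_span[OF _ assms(4) _ w] assms(1,5) lattice_subset_span by blast
  then have "f (h z (h (inverse z) y)) (h z x) = 0"
    using form_invariant wL assms by blast
  then show ?thesis using h_inverse y assms by simp
qed

section \<open>Indecomposable summands against arbitrary summands\<close>

text \<open>The lattice splitting of \<open>A\<close> along \<open>C\<close> has to be one of Hodge
  substructures. The delicate point is stability, because the span of an intersection of lattices
  can a priori be smaller than the intersection of their spans.\<close>

lemma summand_dichotomy: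
  assumes A: "orthogonal_summand L A" "stable A" and C: "orthogonal_summand L C" "stable C"
    and indec: "\<And>K. orthogonal_decomposition A \<psi> h {1, 2::nat} K \<Longrightarrow> K 1 = {0} \<or> K 2 = {0}"
  shows "A \<inter> C = {0} \<or> A \<subseteq> C"
proof -
  let ?C' = "orthogonal_complement L C"
  define D where "D = A \<inter> C"
  define E where "E = A \<inter> ?C'"
  have AL: "zmod.subspace A" "A \<subseteq> L" and CL: "zmod.subspace C" "C \<subseteq> L"
    using A C by (auto simp: orthogonal_summand_def)
  have C': "zmod.subspace ?C'" using CL lattice_subset_span
    by (intro subspace_orthogonal_complement subspace_lattice) auto
  have split: "\<exists>a\<in>D. \<exists>b\<in>E. x = a + b" if "x \<in> A" for x
    using summand_split[OF subspace_lattice lattice_subset_span finite_bounded A(1) C(1) that]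
    unfolding D_def E_def .
  have sub: "zmod.subspace D" "zmod.subspace E"
    using AL CL C' by (auto simp: D_def E_def intro: zmod.subspace_inter)
  have DE: "D \<subseteq> L" "E \<subseteq> L" "D \<subseteq> A" "E \<subseteq> A" "D \<subseteq> C" using AL by (auto simp: D_def E_def)
  have spans: "span D \<subseteq> span L" "span E \<subseteq> span L" "span D \<subseteq> span C" "span D \<subseteq> span A"
    "span E \<subseteq> span A" "span A \<subseteq> span L" "span C \<subseteq> span L"
    using DE AL CL by (auto intro!: span_mono)
  \<comment> \<open>Orthogonality of \<open>C\<close> and \<open>E\<close> extends to the real
    spans, one argument at a time.\<close>
  have E_orth: "f y x = 0" if "y \<in> span C" "x \<in> span E" for x y
  proof -
    have xL: "x \<in> span L" using that spans by auto
    show ?thesis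
    proof (rule orthogonal_span[OF _ xL _ that(1)])
      show "C \<subseteq> span L" using CL lattice_subset_span by auto
      fix c assume c: "c \<in> C"
      then have cL: "c \<in> span L" using CL lattice_subset_span by auto
      have "f e c = 0" if e: "e \<in> E" for e
      proof -
        have "f c e = 0" using c e by (auto simp: E_def orthogonal_complement_def)
        moreover have "e \<in> span L" using e DE(2) lattice_subset_span by blast
        ultimately show ?thesis using commute cL by simp
      qed
      moreover have "E \<subseteq> span L" using DE(2) lattice_subset_span by blast
      ultimately have "f x c = 0" using orthogonal_span cL that(2) by blast
      then show "f c x = 0" using commute cL xL by simp
    qed
  qed
  have span_split: "\<exists>a\<in>span D. \<exists>b\<in>span E. x = a + b" if "x \<in> span A" for x
  proof -
    have "A \<subseteq> span (D \<union> E)"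
      using split by (blast intro: span_add span_base)
    then have "x \<in> span (D \<union> E)" using that span_mono span_span by blast
    then show ?thesis by (auto simp: span_Un)
  qed
  have zero: "x = 0" if "x \<in> span C" "x \<in> span E" for x
    using E_orth[OF that] that spans by (auto intro: self_eq_0)
  \<comment> \<open>Stability of \<open>A\<close> and \<open>C\<close> puts \<open>h z x\<close> in
    both spans. Its component in \<open>span E\<close> then lies in \<open>span C\<close> too, hence
    is 0.\<close>
  have stable_D: "stable D"
    unfolding stable_def
  proof clarify
    fix z x assume z: "z \<noteq> (0::complex)" and x: "x \<in> span D"
    have hA: "h z x \<in> span A" and hC: "h z x \<in> span C"
      using x z spans A(2) C(2) unfolding stable_def by blast+
    obtain a b where ab: "a \<in> span D" "b \<in> span E" "h z x = a + b" using span_split[OF hA] by blast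
    have "h z x - a \<in> span C" using hC ab(1) spans(3) by (intro span_diff) auto
    then have "b = 0" using zero ab(2,3) by simp
    then show "h z x \<in> span D" using ab by simp
  qed
  \<comment> \<open>Here \<open>h z x\<close> remains orthogonal to \<open>C\<close>, and so does
    \<open>b\<close>; the component \<open>a\<close> in \<open>span D\<close> is therefore
    orthogonal to itself.\<close>
  have stable_E: "stable E"
    unfolding stable_def
  proof clarify
    fix z x assume z: "z \<noteq> (0::complex)" and x: "x \<in> span E"
    have hA: "h z x \<in> span A"
      using x z spans A(2) unfolding stable_def by blast
    obtain a b where ab: "a \<in> span D" "b \<in> span E" "h z x = a + b" using span_split[OF hA] by blast
    have aC: "a \<in> span C" and L: "a \<in> span L" "b \<in> span L" "h z x \<in> span L"
      using ab spans hA by auto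
    have "f a (h z x) = 0"
    proof (rule orthogonal_span[of C])
      show "C \<subseteq> span L" using CL lattice_subset_span by auto
      show "f y (h z x) = 0" if "y \<in> C" for y
        using h_orthogonal[OF CL(2) C(2) z _ _ that] E_orth[OF span_base x] x spans(2) by blast
    qed (use L aC in auto)
    moreover have "f a b = 0" using E_orth[OF aC ab(2)] .
    ultimately have "f a a = 0" using L by (simp add: ab(3) add_right)
    then have "a = 0" using L self_eq_0 by blast
    then show "h z x \<in> span E" using ab by simp
  qed
  \<comment> \<open>A decomposition requires both orders of the arguments. Each order uses stability
    of the module on the right.\<close>
  have psi: "\<psi> x y = 0" "\<psi> y x = 0" if "x \<in> D" "y \<in> E" for x y
  proof -
    have f0: "f x y = 0" "f y x = 0" if "x \<in> D" "y \<in> E" for x y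
    proof -
      show "f x y = 0" using E_orth that DE(5) span_base by blast
      moreover have "x \<in> span L" "y \<in> span L" using that DE lattice_subset_span by blast+
      ultimately show "f y x = 0" using commute[of x y] by simp
    qed
    show "\<psi> x y = 0" using pairing_eq_0_if_orthogonal[of D E] DE stable_E f0 that by blast
    show "\<psi> y x = 0" using pairing_eq_0_if_orthogonal[of E D] DE stable_D f0 that by blast
  qed
  let ?K = "\<lambda>i. if i = (1::nat) then D else E"
  have "internal_direct_sum {1, 2::nat} ?K A"
  proof (rule internal_direct_sum_two)
    fix a b a' b' assume *: "a \<in> D" "b \<in> E" "a' \<in> D" "b' \<in> E" "a + b = a' + b'"
    have eq: "a - a' = b' - b" using *(5) by (simp add: algebra_simps)
    have "a - a' \<in> D" "b' - b \<in> E" using * sub by (auto intro: zmod.subspace_diff)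
    then have "a - a' = 0" using DE eq by (intro zero) (auto simp: span_base)
    then show "a = a' \<and> b = b'" using eq by simp
  qed (use DE split in auto)
  then have "orthogonal_decomposition A \<psi> h {1, 2::nat} ?K"
    using sub psi stable_D stable_E unfolding orthogonal_decomposition_def stable_def by simp
  from indec[OF this] have "D = {0} \<or> E = {0}" by simp
  then show ?thesis
  proof
    assume "E = {0}"
    then have "A \<subseteq> D" using split by force
    then show ?thesis using DE by auto
  qed (simp add: D_def)
qed

section \<open>Matching the summands of two decompositions\<close>

text \<open>The components outside index \<open>i\<close> are gathered into one element
  \<open>b\<close>, orthogonal to \<open>M i\<close> because the summands are pairwise
  orthogonal.\<close>

lemma orthogonal_summands:
  assumes dec: "orthogonal_decomposition L \<psi> h I M" and "finite I" "i \<in> I"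
  shows "orthogonal_summand L (M i)"
proof -
  have sub: "zmod.subspace (M j)" "M j \<subseteq> L" "stable (M j)" if "j \<in> I" for j
    using dec that
    by (auto simp: orthogonal_decomposition_def internal_direct_sum_def stable_def)
  have orth: "f x y = 0" if "j \<in> I" "k \<in> I" "j \<noteq> k" "x \<in> M j" "y \<in> M k" for j k x y
    using dec that sub unfolding orthogonal_decomposition_def
    by (intro form_eq_0_if_orthogonal[of "M j" "M k"]) auto
  show ?thesis
    unfolding orthogonal_summand_def
  proof (intro conjI ballI)
    fix x assume x: "x \<in> L"
    obtain g where g: "\<forall>j\<in>I. g j \<in> M j" "x = sum g I"
      using internal_direct_sum_finite[of I M L x] dec x assms(2)
      by (auto simp: orthogonal_decomposition_def)
    have gL: "g j \<in> L" if "j \<in> I" for j using g that sub by auto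
    define b where "b = sum g (I - {i})"
    have "b \<in> L"
      unfolding b_def using gL subspace_lattice by (intro zmod.subspace_sum) auto
    moreover have "f y b = 0" if y: "y \<in> M i" for y
    proof -
      have yL: "y \<in> span L" using y sub(2)[OF assms(3)] lattice_subset_span by blast
      have "f b y = (\<Sum>j\<in>I - {i}. f (g j) y)"
        unfolding b_def using gL lattice_subset_span yL by (intro sum_left) auto
      also have "\<dots> = 0" using orth[OF _ assms(3) _ _ y] g(1) by (intro sum.neutral) blast
      finally show ?thesis using commute yL \<open>b \<in> L\<close> lattice_subset_span by auto
    qed
    ultimately have "b \<in> orthogonal_complement L (M i)"
      by (auto simp: orthogonal_complement_def)
    moreover have "x = g i + b" using g assms by (simp add: b_def sum.remove)
    ultimately show "\<exists>a\<in>M i. \<exists>b\<in>orthogonal_complement L (M i). x = a + b"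
      using g assms(3) by blast
  qed (use sub assms(3) in auto)
qed

text \<open>Otherwise the dichotomy makes \<open>M i\<close> meet every \<open>N j\<close>
  trivially, so splitting along \<open>N j\<close> leaves only the part orthogonal to
  \<open>N j\<close>. Then \<open>M i\<close> is orthogonal to all of \<open>L\<close>, itself
  included, and vanishes.\<close>

lemma summand_subset:
  assumes M: "orthogonal_decomposition L \<psi> h I M" "finite I" "i \<in> I"
    and indec: "indecomposable n (M i) \<psi> h"
    and N: "orthogonal_decomposition L \<psi> h J N" "finite J"
  shows "\<exists>j\<in>J. M i \<subseteq> N j"
proof (rule ccontr)
  assume contr: "\<not> ?thesis"
  have st: "stable (M i)" "\<And>j. j \<in> J \<Longrightarrow> stable (N j)"
    using M N by (auto simp: orthogonal_decomposition_def stable_def)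
  note summand_i = orthogonal_summands[OF M]
  note summand_j = orthogonal_summands[OF N]
  have subL: "M i \<subseteq> L" "zmod.subspace (M i)"
    using summand_i by (auto simp: orthogonal_summand_def)
  have inter: "M i \<inter> N j = {0}" if "j \<in> J" for j
    using summand_dichotomy[OF summand_i st(1) summand_j[OF that] st(2)[OF that]] indec contr that
    by (auto simp: indecomposable_def)
  have "x = 0" if x: "x \<in> M i" for x
  proof -
    have xL: "x \<in> L" "x \<in> span L" using x subL span_base by blast+
    have "f y x = 0" if "j \<in> J" "y \<in> N j" for j y
      using summand_split[OF subspace_lattice lattice_subset_span finite_bounded summand_i
          summand_j[OF that(1)] x] inter[OF that(1)] that(2)
      by (auto simp: orthogonal_complement_def)
    moreover obtain g where g: "\<forall>j\<in>J. g j \<in> N j" "x = sum g J"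
      using internal_direct_sum_finite[of J N L x] N xL
      by (auto simp: orthogonal_decomposition_def)
    moreover have "g j \<in> span L" if "j \<in> J" for j
      using g(1) summand_j[OF that] that lattice_subset_span by (auto simp: orthogonal_summand_def)
    ultimately have "f (sum g J) x = 0"
      using xL by (subst sum_left) (auto intro!: sum.neutral)
    then show ?thesis using g(2) xL self_eq_0 by simp
  qed
  then have "M i = {0}" using zmod.subspace_0[OF subL(2)] by auto
  with indec show False by (simp add: indecomposable_def)
qed

text \<open>Applying the inclusion both ways gives
  \<open>M i \<subseteq> N j \<subseteq> M k\<close>. If \<open>i \<noteq> k\<close>, then
  \<open>M i\<close> is orthogonal to itself and so zero; hence \<open>i = k\<close> and both
  inclusions are equalities.\<close>

lemma summand_mem:
  assumes M: "orthogonal_decomposition L \<psi> h I M" "finite I" "i \<in> I"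
    and N: "orthogonal_decomposition L \<psi> h J N" "finite J"
    and M_indec: "\<And>i. i \<in> I \<Longrightarrow> indecomposable n (M i) \<psi> h"
    and N_indec: "\<And>j. j \<in> J \<Longrightarrow> indecomposable n (N j) \<psi> h"
  shows "M i \<in> N ` J"
proof -
  obtain j where j: "j \<in> J" "M i \<subseteq> N j"
    using summand_subset[OF M M_indec N] M(3) by blast
  obtain k where k: "k \<in> I" "N j \<subseteq> M k"
    using summand_subset[OF N j(1) N_indec M(1,2)] j by blast
  have sub: "zmod.subspace (M i)" "M i \<subseteq> L" "stable (M i)" "M k \<subseteq> L" "stable (M k)"
    using M k by (auto simp: orthogonal_decomposition_def internal_direct_sum_def stable_def)
  have "i = k"
  proof (rule ccontr)
    assume "i \<noteq> k"
    then have orth: "\<psi> x y = 0" if "x \<in> M i" "y \<in> M k" for x y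
      using M k that by (auto simp: orthogonal_decomposition_def)
    have "x = 0" if x: "x \<in> M i" for x
    proof -
      have "f x x = 0"
        using x j k sub orth by (intro form_eq_0_if_orthogonal[of "M i" "M k"]) auto
      then show ?thesis using x sub span_base by (intro self_eq_0) auto
    qed
    then have "M i = {0}" using zmod.subspace_0[OF sub(1)] by auto
    with M_indec[OF M(3)] show False by (simp add: indecomposable_def)
  qed
  then show ?thesis using j k by auto
qed

end

section \<open>The real form of a polarisation\<close>

lemma polarised_hodge_structure_form:
  fixes L :: "'v::real_vector set"
  assumes "polarised_hodge_structure n L \<psi> h"
  shows "\<exists>f \<psi>R. hodge_form L f \<psi> \<psi>R h"
proof -
  have lattice: "free_lattice L" and rep: "real_representation (span L) h"
    using assms by (auto simp: polarised_hodge_structure_def pure_hodge_structure_def)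
  define c where "c = (2 * of_real pi * \<i>) powi n"
  have c: "c \<noteq> 0" by (simp add: c_def)
  have "polarisation n L h \<psi>"
    using assms by (simp add: polarised_hodge_structure_def)
  then obtain \<psi>R where R: "bilinear_within (span L) \<psi>R" "\<forall>x\<in>L. \<forall>y\<in>L. \<psi>R x y = \<psi> x y"
    and inv: "\<forall>z. z \<noteq> 0 \<longrightarrow> (\<forall>x\<in>span L. \<forall>y\<in>span L.
        \<psi>R (h z x) (h z y) = (z * cnj z) powi (- n) * \<psi>R x y)"
    and sym: "\<forall>x\<in>span L. \<forall>y\<in>span L.
        c * \<psi>R x (h \<i> y) \<in> \<real> \<and> c * \<psi>R x (h \<i> y) = c * \<psi>R y (h \<i> x)"
    and pos: "\<forall>x\<in>span L. x \<noteq> 0 \<longrightarrow> Re (c * \<psi>R x (h \<i> x)) > 0"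
    unfolding polarisation_def Let_def c_def[symmetric] by (elim conjE exE) (rule that)
  define f where "f x y = Re (c * \<psi>R x (h \<i> y))" for x y
  have hL: "h z x \<in> span L" if "z \<noteq> 0" "x \<in> span L" for z x
    using rep that by (auto simp: real_representation_def)
  have lin: "linear_within (span L) (\<lambda>x. \<psi>R x y)" if "y \<in> span L" for y
    using R(1) that by (auto simp: bilinear_within_def)
  have f_eq_0: "f x y = 0 \<longleftrightarrow> \<psi>R x (h \<i> y) = 0" if "x \<in> span L" "y \<in> span L" for x y
  proof -
    \<comment> \<open>Since \<phi> takes real values, passing to its real part loses nothing, so the
      zeros agree.\<close>
    have "c * \<psi>R x (h \<i> y) = of_real (f x y)" using sym that unfolding f_def by (metis of_real_Re)
    then show ?thesis using c by (metis mult_eq_0_iff of_real_eq_0_iff)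
  qed
  have "positive_definite_form (span L) f"
  proof
    fix x y z assume xyz: "x \<in> span L" "y \<in> span L" "z \<in> span L"
    then have "\<psi>R (x + y) (h \<i> z) = \<psi>R x (h \<i> z) + \<psi>R y (h \<i> z)"
      using lin[of "h \<i> z"] hL by (simp add: linear_within_def)
    then show "f (x + y) z = f x z + f y z"
      by (simp add: f_def algebra_simps)
  next
    fix a x z assume xz: "x \<in> span L" "z \<in> span L"
    then have "\<psi>R (a *\<^sub>R x) (h \<i> z) = a *\<^sub>R \<psi>R x (h \<i> z)"
      using lin[of "h \<i> z"] hL by (simp add: linear_within_def)
    then show "f (a *\<^sub>R x) z = a * f x z"
      by (simp add: f_def algebra_simps)
    next
    show "f x y = f y x" if "x \<in> span L" "y \<in> span L" for x y
      using sym that unfolding f_def by metis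
    show "f x x > 0" if "x \<in> span L" "x \<noteq> 0" for x
      using pos that unfolding f_def by blast
  qed (rule subspace_span)
  moreover have "f (h z x) (h z y) = 0 \<longleftrightarrow> f x y = 0"
    if z: "z \<noteq> 0" and xy: "x \<in> span L" "y \<in> span L" for z x y
  proof -
    \<comment> \<open>Commutativity of the multiplicative group of \<complex> lets
      \<open>h z\<close> be pulled out of both arguments, so the invariance of
      \<open>\<psi>R\<close> applies.\<close>
    have "h \<i> (h z y) = h z (h \<i> y)"
      using rep z xy unfolding real_representation_def
      by (metis complex_i_not_zero mult.commute)
    then have "\<psi>R (h z x) (h \<i> (h z y)) = (z * cnj z) powi (- n) * \<psi>R x (h \<i> y)"
      using inv z xy hL[of \<i> y] by simp
    then show ?thesis using f_eq_0 hL z xy by simp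
  qed
  ultimately have "hodge_form L f \<psi> \<psi>R h"
    using lattice rep R f_eq_0 by (auto simp: hodge_form_def hodge_form_axioms_def)
  then show ?thesis by blast
qed

theorem theorem6p4:
  fixes n :: int and L :: "'v::real_vector set"
    and \<psi> :: "'v \<Rightarrow> 'v \<Rightarrow> complex" and h :: "complex \<Rightarrow> 'v \<Rightarrow> 'v"
    and r s :: nat and M N :: "nat \<Rightarrow> 'v set"
  assumes "polarised_hodge_structure n L \<psi> h"
    and "orthogonal_decomposition L \<psi> h {1..r} M"
    and "\<And>\<nu>. \<nu> \<in> {1..r} \<Longrightarrow> indecomposable n (M \<nu>) \<psi> h"
    and "orthogonal_decomposition L \<psi> h {1..s} N"
    and "\<And>\<nu>. \<nu> \<in> {1..s} \<Longrightarrow> indecomposable n (N \<nu>) \<psi> h"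
  shows "M ` {1..r} = N ` {1..s}"
proof -
  obtain f \<psi>R where "hodge_form L f \<psi> \<psi>R h"
    using polarised_hodge_structure_form[OF assms(1)] by blast
  then interpret hodge_form L f \<psi> \<psi>R h .
  show ?thesis
    using summand_mem[OF assms(2) _ _ assms(4) _ assms(3,5)]
      summand_mem[OF assms(4) _ _ assms(2) _ assms(5,3)]
    by (intro equalityI image_subsetI) auto
qed

end
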